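(* Let $S$ be a locally compact semigroup, let $\sigma: S\to S$ be a continuous involutive automorphism of $S$, and let $\upsilon$ be a complex Borel measure on $S$ with compact support which is $\sigma$-invariant. The continuous solutions $f:S\to\mathbb{C}$ of the functional equation $$\int_{S}f(xty)\,d\upsilon(t)+\int_{S}f(\sigma(y)tx)\,d\upsilon(t) = 2f(x)f(y),\quad x,y\in S,$$ are exactly the functions $$f=\frac{\psi+\psi\circ\sigma}{2},$$ where $\psi: S\to\mathbb{C}$ is a continuous $\upsilon$-spherical function, that is, $\int_{S}\psi(xsy)\,d\upsilon(s)=\psi(x)\psi(y)$ for all $x,y\in S$.
   Context: A locally compact semigroup is a topological semigroup (continuous associative multiplication) whose topology is locally compact. An involutive automorphism is a map $\sigma:S\to S$ with $\sigma(xy)=\sigma(x)\sigma(y)$ and $\sigma(\sigma(x))=x$ for all $x,y\in S$. The measure $\upsilon$ is $\sigma$-invariant if $\int_{S}h(\sigma(t))\,d\upsilon(t)=\int_{S}h(t)\,d\upsilon(t)$ for all continuous functions $h:S\to\mathbb{C}$. *)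

theory Defs
  imports "HOL-Analysis.Analysis"
begin

text \<open>
  HOL-Analysis has no complex measures. Here a complex (real) Borel measure is a countably additive
  function on the Borel sets with values in the complex (real) numbers. The right-hand side of
  countable additivity converges in the finite sense, so no value is infinite, and the empty set
  has value 0. Values off the Borel sets are irrelevant.
\<close>

definition borel_sigma_additive ::
    "('a::topological_space set \<Rightarrow> 'b::real_normed_vector) \<Rightarrow> bool" where
  "borel_sigma_additive \<nu> \<longleftrightarrow>
     (\<forall>A :: nat \<Rightarrow> 'a set. range A \<subseteq> sets borel \<and> disjoint_family A \<longrightarrow>
        (\<lambda>n. \<nu> (A n)) sums \<nu> (\<Union>n. A n))"

abbreviation complex_borel_measure :: "('a::topological_space set \<Rightarrow> complex) \<Rightarrow> bool" where
  "complex_borel_measure \<equiv> borel_sigma_additive"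

text \<open>
  The positive part in the Jordan decomposition of a real Borel measure,
  \<open>\<nu>\<^sup>+(A) = sup {\<nu>(B) | B \<subseteq> A Borel}\<close>; the negative part of \<open>\<nu>\<close> is the positive part of \<open>-\<nu>\<close>.
  Truncation of negative values by \<open>ennreal\<close> is harmless because \<open>\<nu>({}) = 0\<close>.
\<close>

definition pos_variation :: "('a::topological_space set \<Rightarrow> real) \<Rightarrow> 'a measure" where
  "pos_variation \<nu> = measure_of UNIV (sets borel)
     (\<lambda>A. SUP B\<in>{B \<in> sets borel. B \<subseteq> A}. ennreal (\<nu> B))"

definition real_measure_integral ::
    "('a::topological_space set \<Rightarrow> real) \<Rightarrow> ('a \<Rightarrow> complex) \<Rightarrow> complex" where
  "real_measure_integral \<nu> f =
     (\<integral>t. f t \<partial>pos_variation \<nu>) - (\<integral>t. f t \<partial>pos_variation (\<lambda>A. - \<nu> A))"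

definition complex_measure_integral ::
    "('a::topological_space set \<Rightarrow> complex) \<Rightarrow> ('a \<Rightarrow> complex) \<Rightarrow> complex" where
  "complex_measure_integral \<upsilon> f =
     real_measure_integral (\<lambda>A. Re (\<upsilon> A)) f + \<i> * real_measure_integral (\<lambda>A. Im (\<upsilon> A)) f"

text \<open>
  No regularity is assumed, so compact support means being concentrated on a compact set (for a
  regular measure on a locally compact Hausdorff space this is compactness of the closed support).
  The set \<open>K\<close> need not be Borel, since the Hausdorff property is not assumed either.
\<close>

definition has_compact_support :: "('a::topological_space set \<Rightarrow> complex) \<Rightarrow> bool" where
  "has_compact_support \<upsilon> \<longleftrightarrow>
     (\<exists>K. compact K \<and> (\<forall>A \<in> sets borel. A \<inter> K = {} \<longrightarrow> \<upsilon> A = 0))"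

definition involutive_automorphism :: "('a::semigroup_mult \<Rightarrow> 'a) \<Rightarrow> bool" where
  "involutive_automorphism \<sigma> \<longleftrightarrow> (\<forall>x y. \<sigma> (x * y) = \<sigma> x * \<sigma> y) \<and> (\<forall>x. \<sigma> (\<sigma> x) = x)"

definition measure_invariant ::
    "('a::topological_space set \<Rightarrow> complex) \<Rightarrow> ('a \<Rightarrow> 'a) \<Rightarrow> bool" where
  "measure_invariant \<upsilon> \<sigma> \<longleftrightarrow>
     (\<forall>h. continuous_on UNIV h \<longrightarrow>
        complex_measure_integral \<upsilon> (\<lambda>t. h (\<sigma> t)) = complex_measure_integral \<upsilon> h)"

definition spherical_function ::
    "('a::topological_semigroup_mult set \<Rightarrow> complex) \<Rightarrow> ('a \<Rightarrow> complex) \<Rightarrow> bool" where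
  "spherical_function \<upsilon> \<psi> \<longleftrightarrow>
     (\<forall>x y. complex_measure_integral \<upsilon> (\<lambda>s. \<psi> (x * s * y)) = \<psi> x * \<psi> y)"

text \<open>
  The remaining facts confirm that \<^const>\<open>pos_variation\<close> is a finite measure and that the
  integral above really belongs to \<open>\<upsilon>\<close>: indicators of Borel sets integrate to their measure.
\<close>

lemma borel_sigma_additive_empty:
  assumes "borel_sigma_additive \<nu>" shows "\<nu> {} = 0"
proof -
  have "(\<lambda>n::nat. \<nu> {}) sums \<nu> {}"
    using assms unfolding borel_sigma_additive_def
    by (drule_tac spec[where x="\<lambda>_. {}"]) (auto simp: disjoint_family_on_def)
  then show ?thesis
    using summable_const_iff sums_summable by blast
qed

lemma borel_sigma_additive_Un:
  assumes "borel_sigma_additive \<nu>" "A \<in> sets borel" "B \<in> sets borel" "A \<inter> B = {}"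
  shows "\<nu> (A \<union> B) = \<nu> A + \<nu> B"
proof -
  let ?F = "binaryset A B"
  have "(\<lambda>n. \<nu> (?F n)) sums \<nu> (\<Union>n. ?F n)"
  proof (rule assms(1)[unfolded borel_sigma_additive_def, rule_format], rule conjI)
    show "range ?F \<subseteq> sets borel"
      using assms(2,3) by (simp add: range_binaryset_eq)
    show "disjoint_family ?F"
      using assms(4) by (simp add: disjoint_family_on_def binaryset_def Int_commute)
  qed
  moreover have "(\<lambda>n. \<nu> (?F n)) sums (\<nu> A + \<nu> B)"
    by (rule binaryset_sums) (rule borel_sigma_additive_empty[OF assms(1)])
  ultimately show ?thesis
    by (simp add: UN_binaryset_eq sums_iff)
qed

lemma borel_sigma_additive_Diff:
  assumes "borel_sigma_additive \<nu>" "A \<in> sets borel" "B \<in> sets borel" "B \<subseteq> A"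
  shows "\<nu> (A - B) = \<nu> A - \<nu> B"
proof -
  have "A = B \<union> (A - B)" using assms by auto
  then have "\<nu> A = \<nu> B + \<nu> (A - B)"
    using borel_sigma_additive_Un[OF assms(1,3), of "A - B"] assms by auto
  then show ?thesis by simp
qed

lemma borel_sigma_additive_linear:
  assumes "borel_sigma_additive \<nu>" "bounded_linear L"
  shows "borel_sigma_additive (\<lambda>A. L (\<nu> A))"
  using assms bounded_linear.sums unfolding borel_sigma_additive_def by blast

lemma sets_pos_variation [simp, measurable_cong]: "sets (pos_variation \<nu>) = sets borel"
  and space_pos_variation [simp]: "space (pos_variation \<nu>) = UNIV"
  unfolding pos_variation_def
  using sets.sigma_sets_eq[of borel] by (auto simp: space_measure_of_conv)

context
  fixes \<nu> :: "'a::topological_space set \<Rightarrow> real"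
  assumes nu: "borel_sigma_additive \<nu>"
begin

private definition V :: "'a set \<Rightarrow> ennreal" where
  "V A = (SUP B\<in>{B \<in> sets borel. B \<subseteq> A}. ennreal (\<nu> B))"

private lemma V_upper: "B \<in> sets borel \<Longrightarrow> B \<subseteq> A \<Longrightarrow> ennreal (\<nu> B) \<le> V A"
  unfolding V_def by (rule SUP_upper) auto

private lemma V_superadd:
  assumes "A \<inter> C = {}"
  shows "V A + V C \<le> V (A \<union> C)"
proof -
  have "ennreal (\<nu> B1) + ennreal (\<nu> B2) \<le> V (A \<union> C)"
    if "B1 \<in> sets borel" "B1 \<subseteq> A" "B2 \<in> sets borel" "B2 \<subseteq> C" for B1 B2
  proof (cases "\<nu> B1 \<ge> 0 \<and> \<nu> B2 \<ge> 0")
    case True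
    have "\<nu> (B1 \<union> B2) = \<nu> B1 + \<nu> B2"
      by (rule borel_sigma_additive_Un[OF nu]) (use that assms in auto)
    then have "ennreal (\<nu> B1) + ennreal (\<nu> B2) = ennreal (\<nu> (B1 \<union> B2))"
      using True by simp
    then show ?thesis using V_upper[of "B1 \<union> B2" "A \<union> C"] that by auto
  next
    case False
    then have "ennreal (\<nu> B1) = 0 \<or> ennreal (\<nu> B2) = 0"
      by (auto simp: ennreal_eq_0_iff)
    moreover have "B1 \<subseteq> A \<union> C" "B2 \<subseteq> A \<union> C" using that by auto
    ultimately show ?thesis
      using V_upper[of B1 "A \<union> C"] V_upper[of B2 "A \<union> C"] that(1,3) by auto
  qed
  then have "ennreal (\<nu> B1) + V C \<le> V (A \<union> C)" if "B1 \<in> sets borel" "B1 \<subseteq> A" for B1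
    unfolding V_def[of C] using that
    by (subst add.commute, subst ennreal_SUP_add_left[symmetric])
      (auto simp: add.commute[of _ "ennreal (\<nu> B1)"] intro!: SUP_least)
  then show ?thesis
    unfolding V_def[of A]
    by (subst ennreal_SUP_add_left[symmetric]) (auto intro!: SUP_least)
qed

private lemma V_mono: "A \<subseteq> C \<Longrightarrow> V A \<le> V C"
  unfolding V_def by (rule SUP_subset_mono) auto

private lemma ennreal_sum_le: "ennreal (\<Sum>n<N. f n) \<le> (\<Sum>n<(N::nat). ennreal (f n))"
proof (induction N)
  case (Suc N)
  have "ennreal ((\<Sum>n<N. f n) + f N) \<le> ennreal (max 0 (\<Sum>n<N. f n) + max 0 (f N))"
    by (rule ennreal_leI) auto
  also have "\<dots> = ennreal (\<Sum>n<N. f n) + ennreal (f N)"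
    by (subst ennreal_plus) (auto simp: max_def ennreal_neg)
  finally show ?case using Suc by (auto intro: order_trans add_right_mono)
qed simp

private lemma V_countably_additive: "countably_additive (sets borel) V"
proof (rule countably_additiveI)
  fix A :: "nat \<Rightarrow> 'a set"
  assume A: "range A \<subseteq> sets borel" "disjoint_family A"
  show "(\<Sum>n. V (A n)) = V (\<Union>n. A n)"
  proof (rule antisym)
    have "(\<Sum>n<N. V (A n)) \<le> V (\<Union>n<N. A n)" for N
    proof (induction N)
      case (Suc N)
      have "V (\<Union>n<N. A n) + V (A N) \<le> V ((\<Union>n<N. A n) \<union> A N)"
      proof (rule V_superadd)
        have "A n \<inter> A N = {}" if "n < N" for n
          using disjoint_family_onD[OF A(2), of n N] that by simp
        then show "(\<Union>n<N. A n) \<inter> A N = {}" by auto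
      qed
      also have "(\<Union>n<N. A n) \<union> A N = (\<Union>n<Suc N. A n)"
        by (auto simp: lessThan_Suc)
      finally show ?case using Suc by (auto intro: order_trans add_right_mono)
    qed simp
    then have "(\<Sum>n<N. V (A n)) \<le> V (\<Union>n. A n)" for N
      by (rule order_trans) (auto intro!: V_mono)
    then show "(\<Sum>n. V (A n)) \<le> V (\<Union>n. A n)"
      by (intro suminf_le_const) auto
    show "V (\<Union>n. A n) \<le> (\<Sum>n. V (A n))"
      unfolding V_def[of "\<Union>n. A n"]
    proof (rule SUP_least, clarify)
      fix B assume B: "B \<in> sets borel" "B \<subseteq> (\<Union>n. A n)"
      have "(\<lambda>n. \<nu> (B \<inter> A n)) sums \<nu> (\<Union>n. B \<inter> A n)"
        using nu[unfolded borel_sigma_additive_def, rule_format, of "\<lambda>n. B \<inter> A n"] A B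
        by (auto simp: disjoint_family_on_def)
      moreover have "(\<Union>n. B \<inter> A n) = B" using B by auto
      ultimately have "(\<lambda>N. ennreal (\<Sum>n<N. \<nu> (B \<inter> A n))) \<longlonglongrightarrow> ennreal (\<nu> B)"
        by (simp add: sums_def tendsto_ennrealI)
      moreover have "ennreal (\<Sum>n<N. \<nu> (B \<inter> A n)) \<le> (\<Sum>n. V (A n))" for N
      proof -
        have "ennreal (\<Sum>n<N. \<nu> (B \<inter> A n)) \<le> (\<Sum>n<N. ennreal (\<nu> (B \<inter> A n)))"
          by (rule ennreal_sum_le)
        also have "\<dots> \<le> (\<Sum>n<N. V (A n))"
          using A B by (intro sum_mono V_upper) auto
        also have "\<dots> \<le> (\<Sum>n. V (A n))"
          by (rule sum_le_suminf) auto
        finally show ?thesis .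
      qed
      ultimately show "ennreal (\<nu> B) \<le> (\<Sum>n. V (A n))"
        by (auto intro: LIMSEQ_le_const2)
    qed
  qed
qed

lemma emeasure_pos_variation:
  assumes "A \<in> sets borel"
  shows "emeasure (pos_variation \<nu>) A = (SUP B\<in>{B \<in> sets borel. B \<subseteq> A}. ennreal (\<nu> B))"
proof -
  have "emeasure (pos_variation \<nu>) A = V A"
    unfolding pos_variation_def V_def[symmetric]
  proof (rule emeasure_measure_of_sigma)
    show "sigma_algebra UNIV (sets borel)"
      using sets.sigma_algebra_axioms[of borel] by simp
    show "positive (sets borel) V"
      unfolding positive_def V_def
      by (auto simp: borel_sigma_additive_empty[OF nu] intro!: SUP_eqI)
  qed (use V_countably_additive assms in auto)
  then show ?thesis by (simp add: V_def)
qed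

private lemma V_Un_le:
  assumes "A \<in> sets borel" "C \<in> sets borel"
  shows "V (A \<union> C) \<le> V A + V C"
  using emeasure_subadditive[of A "pos_variation \<nu>" C] assms
  by (simp add: emeasure_pos_variation V_def)

private lemma V_split:
  assumes A: "A \<in> sets borel" "V A = \<infinity>"
  shows "\<exists>F. F \<in> sets borel \<and> F \<subseteq> A \<and> V F = \<infinity> \<and> \<bar>\<nu> (A - F)\<bar> \<ge> 1"
proof -
  have "ennreal (\<bar>\<nu> A\<bar> + 1) < V A" using A by simp
  then obtain B where B: "B \<in> sets borel" "B \<subseteq> A" "ennreal (\<bar>\<nu> A\<bar> + 1) < ennreal (\<nu> B)"
    unfolding V_def less_SUP_iff by auto
  then have big: "\<bar>\<nu> A\<bar> + 1 < \<nu> B"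
    using ennreal_leI[of "\<nu> B" "\<bar>\<nu> A\<bar> + 1"] by (meson not_le)
  have "V B = \<infinity> \<or> V (A - B) = \<infinity>"
    using V_Un_le[of B "A - B"] A B by (auto simp: Un_absorb1 top_unique)
  moreover have "\<bar>\<nu> (A - B)\<bar> \<ge> 1"
    using borel_sigma_additive_Diff[OF nu A(1) B(1,2)] big by simp
  moreover have "\<bar>\<nu> (A - (A - B))\<bar> \<ge> 1"
    using big B(2) by (simp add: double_diff)
  ultimately show ?thesis
    using A(1) B(1,2) by (metis Diff_subset sets.Diff)
qed

lemma finite_measure_pos_variation: "finite_measure (pos_variation \<nu>)"
proof
  have "V UNIV \<noteq> \<infinity>"
  proof
    assume inf: "V UNIV = \<infinity>"
    let ?P = "\<lambda>A. A \<in> sets borel \<and> V A = \<infinity>"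
    have "\<exists>F. \<forall>n. ?P (F n) \<and> (F (Suc n) \<subseteq> F n \<and> \<bar>\<nu> (F n - F (Suc n))\<bar> \<ge> 1)"
    proof (rule dependent_nat_choice)
      show "\<exists>A. ?P A" using inf by auto
      show "\<exists>B. ?P B \<and> (B \<subseteq> A \<and> \<bar>\<nu> (A - B)\<bar> \<ge> 1)" if "?P A" for A and n :: nat
        using V_split[of A] that by auto
    qed
    then obtain F where F: "\<And>n. F n \<in> sets borel" "\<And>n. F (Suc n) \<subseteq> F n"
      "\<And>n. \<bar>\<nu> (F n - F (Suc n))\<bar> \<ge> 1" by auto
    let ?E = "\<lambda>n. F n - F (Suc n)"
    have dec: "F n \<subseteq> F m" if "m \<le> n" for m n
      using lift_Suc_antimono_le[of F] F(2) that by blast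
    have "disjoint_family ?E"
      unfolding disjoint_family_on_def
    proof (intro ballI impI)
      fix m n :: nat assume "m \<noteq> n"
      then have "Suc m \<le> n \<or> Suc n \<le> m" by auto
      then show "?E m \<inter> ?E n = {}" using dec by blast
    qed
    then have "(\<lambda>n. \<nu> (?E n)) sums \<nu> (\<Union>n. ?E n)"
      using F(1) by (intro nu[unfolded borel_sigma_additive_def, rule_format]) auto
    then have "(\<lambda>n. \<nu> (?E n)) \<longlonglongrightarrow> 0"
      by (intro summable_LIMSEQ_zero sums_summable)
    then have "(\<lambda>n. \<bar>\<nu> (?E n)\<bar>) \<longlonglongrightarrow> 0"
      by (rule tendsto_rabs_zero)
    then have "1 \<le> (0::real)"
      by (rule LIMSEQ_le_const) (use F(3) in auto)
    then show False by simp
  qed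
  then show "emeasure (pos_variation \<nu>) (space (pos_variation \<nu>)) \<noteq> \<infinity>"
    by (simp add: emeasure_pos_variation V_def)
qed

end

lemma borel_sigma_additive_uminus:
  fixes \<nu> :: "'a::topological_space set \<Rightarrow> real"
  shows "borel_sigma_additive \<nu> \<Longrightarrow> borel_sigma_additive (\<lambda>A. - \<nu> A)"
  by (rule borel_sigma_additive_linear) (auto intro: bounded_linear_minus bounded_linear_ident)

lemma jordan_decomposition:
  assumes nu: "borel_sigma_additive \<nu>" and A: "A \<in> sets borel"
  shows "measure (pos_variation \<nu>) A - measure (pos_variation (\<lambda>A. - \<nu> A)) A = \<nu> A"
proof -
  have le: "measure (pos_variation \<mu>) A \<le> \<mu> A + measure (pos_variation (\<lambda>A. - \<mu> A)) A"
    if mu: "borel_sigma_additive \<mu>" for \<mu> :: "'a set \<Rightarrow> real"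
  proof -
    note mu' = borel_sigma_additive_uminus[OF mu]
    interpret P: finite_measure "pos_variation \<mu>" by (rule finite_measure_pos_variation[OF mu])
    interpret N: finite_measure "pos_variation (\<lambda>A. - \<mu> A)"
      by (rule finite_measure_pos_variation[OF mu'])
    have bound: "\<mu> B \<le> \<mu> A + measure (pos_variation (\<lambda>A. - \<mu> A)) A" if B: "B \<in> sets borel" "B \<subseteq> A" for B
    proof -
      have "ennreal (- \<mu> (A - B)) \<le> emeasure (pos_variation (\<lambda>A. - \<mu> A)) A"
        unfolding emeasure_pos_variation[OF mu' A] by (rule SUP_upper) (use A B in auto)
      then have "- \<mu> (A - B) \<le> measure (pos_variation (\<lambda>A. - \<mu> A)) A"
        by (simp add: N.emeasure_eq_measure ennreal_le_iff)
      then show ?thesis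
        using borel_sigma_additive_Diff[OF mu A B] by simp
    qed
    have nn: "0 \<le> \<mu> A + measure (pos_variation (\<lambda>A. - \<mu> A)) A"
      using bound[of "{}"] borel_sigma_additive_empty[OF mu] by simp
    have "emeasure (pos_variation \<mu>) A \<le> ennreal (\<mu> A + measure (pos_variation (\<lambda>A. - \<mu> A)) A)"
      unfolding emeasure_pos_variation[OF mu A]
      by (rule SUP_least) (auto intro!: ennreal_leI bound)
    then show ?thesis
      using nn by (simp add: P.emeasure_eq_measure ennreal_le_iff)
  qed
  show ?thesis
    using le[OF nu] le[OF borel_sigma_additive_uminus[OF nu]] by simp
qed

lemma complex_measure_integral_indicator:
  assumes "complex_borel_measure \<upsilon>" "A \<in> sets borel"
  shows "complex_measure_integral \<upsilon> (indicator A) = \<upsilon> A"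
proof -
  have ind: "(indicator A :: 'a \<Rightarrow> complex) = (\<lambda>t. of_real (indicator A t))"
    by (auto simp: indicator_def)
  have "real_measure_integral \<nu> (indicator A) = of_real (\<nu> A)"
    if "borel_sigma_additive \<nu>" for \<nu> :: "'a set \<Rightarrow> real"
    unfolding real_measure_integral_def ind integral_complex_of_real
    using jordan_decomposition[OF that assms(2)] by (simp flip: of_real_diff)
  then show ?thesis
    using borel_sigma_additive_linear[OF assms(1) bounded_linear_Re]
      borel_sigma_additive_linear[OF assms(1) bounded_linear_Im]
    by (simp add: complex_measure_integral_def complex_eq_iff)
qed

end

theory Submission
  imports Defs
begin

text \<open>
  Against continuous functions, \<open>\<upsilon>\<close> acts as a functional bounded by the supremum over a compact set,
  and for such functionals Fubini's theorem holds for jointly continuous integrands. Hence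
  \<open>x \<circ> y = x \<upsilon> y\<close> behaves like an associative multiplication of which \<open>\<sigma>\<close> is an automorphism, and the
  equation becomes the variant \<open>f(x \<circ> y) + f(\<sigma>(y) \<circ> x) = 2 f(x) f(y)\<close> of d'Alembert's equation.
  Expanding \<open>f(x \<circ> y \<circ> z)\<close> shows that each \<open>h(x) = f(x \<circ> a) - f(x) f(a)\<close> satisfies the sine addition
  law \<open>h(x \<circ> y) = h(x) f(y) + f(x) h(y)\<close>. If some \<open>h\<close> is nonzero, associativity gives
  \<open>f(x \<circ> y) = f(x) f(y) + b\<^sup>2 h(x) h(y)\<close> for a constant \<open>b\<close>, so \<open>\<psi> = f + b h\<close> is
  \<open>\<upsilon>\<close>-spherical, and \<open>\<psi> \<circ> \<sigma> = f - b h\<close>.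
\<close>

section \<open>Functionals bounded by the supremum over a compact set\<close>

lemma continuous_compose:
  "continuous_on UNIV \<phi> \<Longrightarrow> continuous_on UNIV g \<Longrightarrow> continuous_on UNIV (\<lambda>x. \<phi> (g x))"
  by (rule continuous_on_compose2[of UNIV \<phi> UNIV g]) auto

lemma continuous_section:
  assumes "continuous_on UNIV (\<lambda>(x, t). F x t)"
  shows "continuous_on UNIV (F x)" "continuous_on UNIV (\<lambda>x. F x t)"
  using continuous_on_compose2[OF assms continuous_on_Pair[OF continuous_on_const[of UNIV x] continuous_on_id]]
    continuous_on_compose2[OF assms continuous_on_Pair[OF continuous_on_id continuous_on_const[of UNIV t]]]
  by auto

text \<open>Compactness and integral estimates below give only non-strict bounds; passing to
  \<open>e / 2\<close> restores the strict one.\<close>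

lemma continuous_onI_neighbourhood:
  fixes g :: "'b::topological_space \<Rightarrow> 'c::metric_space"
  assumes "\<And>x0 e. e > 0 \<Longrightarrow> \<exists>X. open X \<and> x0 \<in> X \<and> (\<forall>x\<in>X. dist (g x) (g x0) \<le> e)"
  shows "continuous_on UNIV g"
  unfolding continuous_on_def
proof (intro ballI tendstoI)
  fix x0 :: 'b and e :: real assume "e > 0"
  then obtain X where "open X" "x0 \<in> X" "\<forall>x\<in>X. dist (g x) (g x0) \<le> e / 2"
    using assms[of "e / 2" x0] by auto
  with \<open>e > 0\<close> show "\<forall>\<^sub>F x in at x0. dist (g x) (g x0) < e"
    unfolding eventually_at_topological by (intro exI[of _ X]) force
qed

text \<open>These are the only properties of the integral used below, apart from
  \<open>\<sigma>\<close>-invariance. Taking \<open>e = 0\<close> in \<open>bound\<close> shows that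
  \<open>I h\<close> depends only on \<open>h\<close> restricted to \<open>K\<close>, although
  \<open>h\<close> is required to be continuous everywhere.\<close>

locale compact_functional =
  fixes I :: "('a::topological_space \<Rightarrow> complex) \<Rightarrow> complex"
    and K :: "'a set" and C :: real
  assumes compact_K: "compact K"
    and add: "continuous_on UNIV h \<Longrightarrow> continuous_on UNIV k \<Longrightarrow> I (\<lambda>t. h t + k t) = I h + I k"
    and cmult: "continuous_on UNIV h \<Longrightarrow> I (\<lambda>t. c * h t) = c * I h"
    and bound: "continuous_on UNIV h \<Longrightarrow> 0 \<le> e \<Longrightarrow> (\<And>t. t \<in> K \<Longrightarrow> norm (h t) \<le> e) \<Longrightarrow>
      norm (I h) \<le> C * e"
    and C_nonneg: "0 \<le> C"
begin

lemma diff: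
  assumes "continuous_on UNIV h" "continuous_on UNIV k"
  shows "I (\<lambda>t. h t - k t) = I h - I k"
  using add[of h "\<lambda>t. (-1) * k t"] cmult[of k "-1"] assms
  by (simp add: continuous_intros)

lemma sum:
  assumes "finite J" "\<And>j. j \<in> J \<Longrightarrow> continuous_on UNIV (h j)"
  shows "I (\<lambda>t. \<Sum>j\<in>J. h j t) = (\<Sum>j\<in>J. I (h j))"
  using assms
proof (induction J rule: finite_induct)
  case empty
  then show ?case using cmult[of "\<lambda>_. 0" 0] by simp
next
  case (insert j J)
  then show ?case
    by (simp add: add continuous_on_sum)
qed

text \<open>Tube lemma: compactness of \<open>K\<close> lets one neighbourhood of \<open>x0\<close>
  serve all \<open>t\<close> in \<open>K\<close>.\<close>

lemma uniform_neighbourhood: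
  fixes F :: "'b::topological_space \<Rightarrow> 'a \<Rightarrow> complex"
  assumes "continuous_on UNIV (\<lambda>(x, t). F x t)" "e > 0"
  obtains X where "open X" "x0 \<in> X" "\<And>x t. x \<in> X \<Longrightarrow> t \<in> K \<Longrightarrow> norm (F x t - F x0 t) \<le> e"
proof -
  have "continuous_on (UNIV \<times> K) (\<lambda>(x, t). F x t)"
    using assms(1) continuous_on_subset by blast
  then show ?thesis
    by (rule continuous_on_prod_compactE[OF _ compact_K UNIV_I assms(2), of _ x0])
      (use that in \<open>auto simp: dist_norm\<close>)
qed

lemma continuous_parameter:
  fixes F :: "'b::topological_space \<Rightarrow> 'a \<Rightarrow> complex"
  assumes F: "continuous_on UNIV (\<lambda>(x, t). F x t)"
  shows "continuous_on UNIV (\<lambda>x. I (F x))"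
proof (rule continuous_onI_neighbourhood)
  fix x0 :: 'b and e :: real assume e: "e > 0"
  \<comment> \<open>\<open>C\<close> may be 0, hence the division by \<open>C + 1\<close>.\<close>
  then have e': "e / (C + 1) > 0" using C_nonneg by simp
  obtain X where X: "open X" "x0 \<in> X"
    and le: "\<And>x t. x \<in> X \<Longrightarrow> t \<in> K \<Longrightarrow> norm (F x t - F x0 t) \<le> e / (C + 1)"
    using uniform_neighbourhood[OF F e'] by metis
  have "dist (I (F x)) (I (F x0)) \<le> e" if "x \<in> X" for x
  proof -
    have "dist (I (F x)) (I (F x0)) = norm (I (\<lambda>t. F x t - F x0 t))"
      by (simp add: diff continuous_section(1)[OF F] dist_norm)
    also have "\<dots> \<le> C * (e / (C + 1))"
      using e' le that by (intro bound continuous_intros continuous_section(1)[OF F]) auto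
    also have "\<dots> \<le> e"
      using C_nonneg e by (simp add: field_simps)
    finally show ?thesis .
  qed
  with X show "\<exists>X. open X \<and> x0 \<in> X \<and> (\<forall>x\<in>X. dist (I (F x)) (I (F x0)) \<le> e)"
    by blast
qed

text \<open>By the triangle inequality, suprema of norms differ by at most the supremum of the norm
  of the difference. Supplies the distances between sections of \<open>F\<close> for the partition
  of unity.\<close>

lemma continuous_SUP_norm:
  fixes F :: "'b::topological_space \<Rightarrow> 'a \<Rightarrow> complex"
  assumes F: "continuous_on UNIV (\<lambda>(x, t). F x t)" and "K \<noteq> {}"
  shows "continuous_on UNIV (\<lambda>x. SUP t\<in>K. norm (F x t))"
    and "t \<in> K \<Longrightarrow> norm (F x t) \<le> (SUP t\<in>K. norm (F x t))"
proof -
  have upper: "norm (F x t) \<le> (SUP t\<in>K. norm (F x t))" if "t \<in> K" for x t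
  proof -
    have "continuous_on K (\<lambda>t. norm (F x t))"
      using continuous_on_subset[OF continuous_section(1)[OF F]] by (intro continuous_intros) auto
    then have "bounded ((\<lambda>t. norm (F x t)) ` K)"
      by (intro compact_imp_bounded compact_continuous_image compact_K)
    then show ?thesis
      using that by (intro cSUP_upper bounded_imp_bdd_above)
  qed
  then show "t \<in> K \<Longrightarrow> norm (F x t) \<le> (SUP t\<in>K. norm (F x t))" .
  show "continuous_on UNIV (\<lambda>x. SUP t\<in>K. norm (F x t))"
  proof (rule continuous_onI_neighbourhood)
    fix x0 :: 'b and e :: real assume "e > 0"
    then obtain X where X: "open X" "x0 \<in> X"
      and le: "\<And>x t. x \<in> X \<Longrightarrow> t \<in> K \<Longrightarrow> norm (F x t - F x0 t) \<le> e"
      using uniform_neighbourhood[OF F] by metis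
    have half: "(SUP t\<in>K. norm (F y t)) \<le> (SUP t\<in>K. norm (F z t)) + e"
      if "\<And>t. t \<in> K \<Longrightarrow> norm (F y t - F z t) \<le> e" for y z
    proof (rule cSUP_least[OF \<open>K \<noteq> {}\<close>])
      fix t assume "t \<in> K"
      then show "norm (F y t) \<le> (SUP t\<in>K. norm (F z t)) + e"
        using that upper[of t z] norm_triangle_ineq2[of "F y t" "F z t"] by fastforce
    qed
    have "dist (SUP t\<in>K. norm (F x t)) (SUP t\<in>K. norm (F x0 t)) \<le> e" if "x \<in> X" for x
      using half[of x x0] half[of x0 x] le[OF that] by (simp add: dist_real_def norm_minus_commute abs_le_iff)
    with X show "\<exists>X. open X \<and> x0 \<in> X \<and>
        (\<forall>x\<in>X. dist (SUP t\<in>K. norm (F x t)) (SUP t\<in>K. norm (F x0 t)) \<le> e)"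
      by blast
  qed
qed

text \<open>
  The functions \<open>h j\<close> form a partition of unity on \<open>K\<close>, built from the distances of the sections of \<open>F\<close>
  in the supremum norm; this needs neither the Hausdorff property nor product measurability.
\<close>

lemma tensor_approximation:
  fixes F :: "'a \<Rightarrow> 'a \<Rightarrow> complex"
  assumes F: "continuous_on UNIV (\<lambda>(s, t). F s t)" and e: "e > 0" and K: "K \<noteq> {}"
  obtains J h where "finite J" "\<And>j. continuous_on UNIV (h j)"
    "\<And>s t. s \<in> K \<Longrightarrow> t \<in> K \<Longrightarrow> norm (F s t - (\<Sum>j\<in>J. h j s * F j t)) \<le> e"
proof -
  define d where "d j s = (SUP t\<in>K. norm (F s t - F j t))" for j s
  have G: "continuous_on UNIV (\<lambda>(s, t). F s t - F j t)" for j
    using F continuous_on_compose2[OF continuous_section(1)[OF F] continuous_on_snd[OF continuous_on_id]]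
    unfolding case_prod_beta by (intro continuous_on_diff) auto
  have d_cont: "continuous_on UNIV (d j)" for j
    unfolding d_def using continuous_SUP_norm(1)[of "\<lambda>s t. F s t - F j t"] G K by simp
  have d_upper: "norm (F s t - F j t) \<le> d j s" if "t \<in> K" for j s t
    unfolding d_def using continuous_SUP_norm(2)[of "\<lambda>s t. F s t - F j t"] G K that by simp
  have d_self: "d j j = 0" for j
    unfolding d_def using K by simp
  have "open {s. d j s < e}" for j
    using open_Collect_less[OF d_cont continuous_on_const] by auto
  moreover have "K \<subseteq> (\<Union>j\<in>K. {s. d j s < e})"
    using d_self e by auto
  ultimately obtain J where J: "J \<subseteq> K" "finite J" "K \<subseteq> (\<Union>j\<in>J. {s. d j s < e})"
    using compactE_image[OF compact_K, of K "\<lambda>j. {s. d j s < e}"] by metis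
  \<comment> \<open>A tent function: positive exactly where the section of \<open>F\<close> at
    \<open>s\<close> is closer than \<open>e\<close> to the section at \<open>j\<close>, uniformly
    on \<open>K\<close>.\<close>
  define w where "w j s = max 0 (e - d j s)" for j s
  define D where "D s = (\<Sum>j\<in>J. w j s)" for s
  have w_cont: "continuous_on UNIV (w j)" for j
    unfolding w_def by (intro continuous_intros d_cont)
  have D_cont: "continuous_on UNIV D"
    unfolding D_def by (intro continuous_intros w_cont)
  have w_nonneg: "0 \<le> w j s" for j s
    unfolding w_def by simp
  have D_pos: "D s > 0" if s: "s \<in> K" for s
  proof -
    obtain j where "j \<in> J" "d j s < e" using J(3) s by auto
    then show ?thesis
      unfolding D_def by (intro sum_pos2[OF J(2) \<open>j \<in> J\<close>]) (auto simp: w_def)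
  qed
  \<comment> \<open>\<open>D\<close> may vanish off \<open>K\<close>. Its positive minimum on
    \<open>K\<close> is a floor for the denominator, which makes \<open>h j\<close> continuous
    everywhere without changing it on \<open>K\<close>.\<close>
  obtain s0 where s0: "s0 \<in> K" "\<And>s. s \<in> K \<Longrightarrow> D s0 \<le> D s"
    using continuous_attains_inf[OF compact_K K continuous_on_subset[OF D_cont]] by auto
  define h where "h j s = complex_of_real (w j s / max (D s) (D s0))" for j s
  show ?thesis
  proof (rule that[OF J(2)])
    show "continuous_on UNIV (h j)" for j
      unfolding h_def using D_pos[OF s0(1)]
      by (intro continuous_intros w_cont D_cont) (auto simp: max_def split: if_splits)
    fix s t assume st: "s \<in> K" "t \<in> K"
    have max: "max (D s) (D s0) = D s" using s0(2)[OF st(1)] by simp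
    have "(\<Sum>j\<in>J. h j s) = 1"
      unfolding h_def max using D_pos[OF st(1)]
      by (simp add: D_def flip: of_real_sum sum_divide_distrib)
    then have "F s t - (\<Sum>j\<in>J. h j s * F j t) = (\<Sum>j\<in>J. h j s * (F s t - F j t))"
      by (simp add: right_diff_distrib sum_subtractf flip: sum_distrib_right)
    also have "norm \<dots> \<le> (\<Sum>j\<in>J. (w j s / D s) * e)"
    proof (rule sum_norm_le)
      fix j
      show "norm (h j s * (F s t - F j t)) \<le> (w j s / D s) * e"
      proof (cases "d j s < e")
        case True
        then show ?thesis
          using d_upper[OF st(2), of s j] w_nonneg[of j s] D_pos[OF st(1)]
          unfolding norm_mult h_def max by (intro mult_mono) (auto simp: norm_divide)
      next
        case False
        then show ?thesis by (simp add: h_def w_def)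
      qed
    qed
    also have "\<dots> = e"
      using D_pos[OF st(1)] by (simp add: D_def flip: sum_distrib_right sum_divide_distrib)
    finally show "norm (F s t - (\<Sum>j\<in>J. h j s * F j t)) \<le> e" .
  qed
qed

text \<open>For a finite sum of products of continuous functions both orders give the same value by
  linearity. Approximating \<open>F\<close> uniformly on \<open>K\<close> by such a sum brings both
  iterated integrals within an arbitrarily small distance of that value.\<close>

lemma fubini:
  assumes F: "continuous_on UNIV (\<lambda>(s, t). F s t)"
  shows "I (\<lambda>s. I (\<lambda>t. F s t)) = I (\<lambda>t. I (\<lambda>s. F s t))"
proof (cases "K = {}")
  case True
  have zero: "I h = 0" if "continuous_on UNIV h" for h
    using bound[OF that, of 0] True by simp
  show ?thesis
    by (simp add: zero continuous_section[OF F])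
next
  case False
  have F': "continuous_on UNIV (\<lambda>(t, s). F s t)"
    using continuous_on_compose2[OF F continuous_on_swap, of UNIV]
    by (simp add: case_prod_beta prod.swap_def)
  have "norm (I (\<lambda>s. I (F s)) - I (\<lambda>t. I (\<lambda>s. F s t))) \<le> 0 + e" if e: "e > 0" for e
  proof -
    \<comment> \<open>Each order of integration costs an error \<open>C * (C * e')\<close>; the
      added 1 keeps the denominator positive.\<close>
    define e' where "e' = e / (2 * C * C + 1)"
    have pos: "2 * C * C + 1 > 0" using C_nonneg by (simp add: add_nonneg_pos)
    then have e': "e' > 0" using e by (simp add: e'_def)
    obtain J h where J: "finite J" and h: "\<And>j. continuous_on UNIV (h j)"
      and le: "\<And>s t. s \<in> K \<Longrightarrow> t \<in> K \<Longrightarrow> norm (F s t - (\<Sum>j\<in>J. h j s * F j t)) \<le> e'"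
      using tensor_approximation[OF F e' False] by metis
    let ?m = "\<Sum>j\<in>J. I (h j) * I (F j)"
    note cont = continuous_section[OF F] continuous_parameter[OF F] continuous_parameter[OF F'] h
    have 1: "norm (I (\<lambda>s. I (F s)) - ?m) \<le> C * (C * e')"
    proof -
      have in1: "I (\<lambda>t. F s t - (\<Sum>j\<in>J. h j s * F j t)) = I (F s) - (\<Sum>j\<in>J. I (F j) * h j s)" for s
        using J by (simp add: diff sum cmult cont continuous_intros) (simp add: mult.commute)
      have "I (\<lambda>s. I (F s)) - ?m = I (\<lambda>s. I (F s) - (\<Sum>j\<in>J. I (F j) * h j s))"
        using J by (simp add: diff sum cmult cont continuous_intros) (simp add: mult.commute)
      also have "norm \<dots> \<le> C * (C * e')"
      proof (rule bound)
        fix s assume "s \<in> K"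
        then show "norm (I (F s) - (\<Sum>j\<in>J. I (F j) * h j s)) \<le> C * e'"
          using e' le unfolding in1[symmetric]
          by (intro bound continuous_intros cont) auto
      qed (use e' C_nonneg in \<open>auto intro!: continuous_intros cont\<close>)
      finally show ?thesis .
    qed
    have 2: "norm (I (\<lambda>t. I (\<lambda>s. F s t)) - ?m) \<le> C * (C * e')"
    proof -
      have in2: "I (\<lambda>s. F s t - (\<Sum>j\<in>J. F j t * h j s)) = I (\<lambda>s. F s t) - (\<Sum>j\<in>J. I (h j) * F j t)" for t
        using J by (simp add: diff sum cmult cont continuous_intros) (simp add: mult.commute)
      have "I (\<lambda>t. I (\<lambda>s. F s t)) - ?m = I (\<lambda>t. I (\<lambda>s. F s t) - (\<Sum>j\<in>J. I (h j) * F j t))"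
        using J by (simp add: diff sum cmult cont continuous_intros)
      also have "norm \<dots> \<le> C * (C * e')"
      proof (rule bound)
        fix t assume "t \<in> K"
        then show "norm (I (\<lambda>s. F s t) - (\<Sum>j\<in>J. I (h j) * F j t)) \<le> C * e'"
          using e' le unfolding in2[symmetric]
          by (intro bound continuous_intros cont) (auto simp: mult.commute)
      qed (use e' C_nonneg in \<open>auto intro!: continuous_intros cont\<close>)
      finally show ?thesis .
    qed
    have "norm (I (\<lambda>s. I (F s)) - I (\<lambda>t. I (\<lambda>s. F s t))) \<le> 2 * C * C * e'"
      using 1 2 norm_triangle_ineq4[of "I (\<lambda>s. I (F s)) - ?m" "I (\<lambda>t. I (\<lambda>s. F s t)) - ?m"]
      by (simp add: mult.assoc)
    also have "\<dots> \<le> 0 + e"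
      using pos e by (simp add: e'_def field_simps)
    finally show ?thesis .
  qed
  then show ?thesis
    using field_le_epsilon[of "norm (I (\<lambda>s. I (F s)) - I (\<lambda>t. I (\<lambda>s. F s t)))" 0] by simp
qed

end

section \<open>The integral of a compactly supported complex measure\<close>

text \<open>\<open>K\<close> need not be measurable, so the estimate goes through the open set where
  \<open>norm (h t)\<close> exceeds \<open>e\<close>: it misses \<open>K\<close> and is therefore
  null.\<close>

lemma concentrated_integral:
  fixes M :: "'a::topological_space measure" and h :: "'a \<Rightarrow> complex"
  assumes fin: "finite_measure M" and sets: "sets M = sets borel"
    and null: "\<And>A. A \<in> sets borel \<Longrightarrow> A \<inter> K = {} \<Longrightarrow> emeasure M A = 0"
    and h: "continuous_on UNIV h" and le: "\<And>t. t \<in> K \<Longrightarrow> norm (h t) \<le> e"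
  shows "integrable M h" and "norm (\<integral>t. h t \<partial>M) \<le> measure M (space M) * e"
proof -
  interpret finite_measure M by (rule fin)
  have meas: "h \<in> borel_measurable M"
    using borel_measurable_continuous_onI[OF h] measurable_cong_sets[OF sets refl] by auto
  have AE: "AE t in M. norm (h t) \<le> e"
  proof (rule AE_I)
    have op: "open {t. e < norm (h t)}"
      by (intro open_Collect_less continuous_intros h)
    then show "emeasure M {t. e < norm (h t)} = 0"
      using le by (intro null) fastforce+
    show "{t. e < norm (h t)} \<in> sets M" using op sets by simp
  qed auto
  show int: "integrable M h"
    by (rule integrable_const_bound[OF AE meas])
  have "norm (\<integral>t. h t \<partial>M) \<le> (\<integral>t. norm (h t) \<partial>M)"
    by (rule integral_norm_bound)
  also have "\<dots> \<le> (\<integral>t. e \<partial>M)"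
    using int AE by (intro integral_mono_AE) auto
  finally show "norm (\<integral>t. h t \<partial>M) \<le> measure M (space M) * e"
    by simp
qed

text \<open>Applied with \<open>a = -1\<close> to the two Jordan parts and with
  \<open>a = \<i>\<close> to the real and imaginary parts.\<close>

lemma compact_functional_combine:
  assumes "compact_functional I K C" "compact_functional J K D"
  shows "compact_functional (\<lambda>h. I h + a * J h) K (C + norm a * D)"
proof -
  interpret I: compact_functional I K C by fact
  interpret J: compact_functional J K D by fact
  show ?thesis
  proof
    fix h :: "'a \<Rightarrow> complex" and e :: real
    assume h: "continuous_on UNIV h" "0 \<le> e" "\<And>t. t \<in> K \<Longrightarrow> norm (h t) \<le> e"
    have "norm (I h + a * J h) \<le> norm (I h) + norm a * norm (J h)"
      using norm_triangle_ineq[of "I h" "a * J h"] by (simp add: norm_mult)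
    also have "\<dots> \<le> C * e + norm a * (D * e)"
      by (intro add_mono mult_left_mono I.bound J.bound h) auto
    finally show "norm (I h + a * J h) \<le> (C + norm a * D) * e"
      by (simp add: algebra_simps)
  qed (auto simp: I.add J.add I.cmult J.cmult I.C_nonneg J.C_nonneg I.compact_K algebra_simps)
qed

lemma compact_functional_pos_variation:
  fixes \<nu> :: "'a::topological_space set \<Rightarrow> real"
  assumes nu: "borel_sigma_additive \<nu>" and K: "compact K"
    and supp: "\<And>A. A \<in> sets borel \<Longrightarrow> A \<inter> K = {} \<Longrightarrow> \<nu> A = 0"
  shows "compact_functional (\<lambda>h. \<integral>t. h t \<partial>pos_variation \<nu>) K (measure (pos_variation \<nu>) UNIV)"
proof -
  let ?M = "pos_variation \<nu>"
  have null: "emeasure ?M A = 0" if "A \<in> sets borel" "A \<inter> K = {}" for A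
  proof -
    \<comment> \<open>Borel subsets of a set missing \<open>K\<close> miss \<open>K\<close> too, so
      the supremum defining the positive variation of \<open>A\<close> is 0.\<close>
    have "\<nu> B = 0" if "B \<in> sets borel" "B \<subseteq> A" for B
      using \<open>A \<inter> K = {}\<close> that by (intro supp) auto
    then show ?thesis
      by (auto simp: emeasure_pos_variation[OF nu \<open>A \<in> sets borel\<close>] intro!: SUP_eqI)
  qed
  note conc = concentrated_integral[OF finite_measure_pos_variation[OF nu] sets_pos_variation null]
  have int: "integrable ?M h" if h: "continuous_on UNIV h" for h :: "'a \<Rightarrow> complex"
  proof -
    have "bounded (h ` K)"
      by (intro compact_imp_bounded compact_continuous_image K continuous_on_subset[OF h]) auto
    then obtain e where "\<And>t. t \<in> K \<Longrightarrow> norm (h t) \<le> e"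
      unfolding bounded_iff by auto
    then show ?thesis using conc(1)[OF _ _ h] by blast
  qed
  show ?thesis
  proof
    show "norm (\<integral>t. h t \<partial>?M) \<le> measure ?M UNIV * e"
      if "continuous_on UNIV h" "\<And>t. t \<in> K \<Longrightarrow> norm (h t) \<le> e" for h :: "'a \<Rightarrow> complex" and e
      using conc(2)[OF _ _ that] by simp
  qed (auto simp: K int)
qed

lemma compact_functional_complex_measure_integral:
  assumes ups: "complex_borel_measure \<upsilon>" and "has_compact_support \<upsilon>"
  shows "\<exists>K C. compact_functional (complex_measure_integral \<upsilon>) K C"
proof -
  obtain K where K: "compact K" and supp: "\<And>A. A \<in> sets borel \<Longrightarrow> A \<inter> K = {} \<Longrightarrow> \<upsilon> A = 0"
    using assms(2) unfolding has_compact_support_def by blast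
  have real: "\<exists>C. compact_functional (real_measure_integral \<nu>) K C"
    if nu: "borel_sigma_additive \<nu>" and "\<And>A. A \<in> sets borel \<Longrightarrow> A \<inter> K = {} \<Longrightarrow> \<nu> A = 0" for \<nu>
    using compact_functional_combine[OF
        compact_functional_pos_variation[OF nu K that(2)]
        compact_functional_pos_variation[OF borel_sigma_additive_uminus[OF nu] K], of "-1"] that(2)
    unfolding real_measure_integral_def[abs_def] by auto
  obtain C D where "compact_functional (real_measure_integral (\<lambda>A. Re (\<upsilon> A))) K C"
    "compact_functional (real_measure_integral (\<lambda>A. Im (\<upsilon> A))) K D"
    using real[OF borel_sigma_additive_linear[OF ups bounded_linear_Re]]
      real[OF borel_sigma_additive_linear[OF ups bounded_linear_Im]] supp by auto
  from compact_functional_combine[OF this, of \<i>] show ?thesis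
    unfolding complex_measure_integral_def[abs_def] by blast
qed

section \<open>The variant of d'Alembert's equation\<close>

locale involutive_functional = compact_functional I K C
  for I :: "('a::topological_semigroup_mult \<Rightarrow> complex) \<Rightarrow> complex" and K C +
  fixes \<sigma> :: "'a \<Rightarrow> 'a"
  assumes sigma_mult: "\<sigma> (x * y) = \<sigma> x * \<sigma> y"
    and sigma_sigma [simp]: "\<sigma> (\<sigma> x) = x"
    and continuous_sigma: "continuous_on UNIV \<sigma>"
    and invariant: "continuous_on UNIV h \<Longrightarrow> I (\<lambda>t. h (\<sigma> t)) = I h"
begin

text \<open>Stands for the value of \<open>\<phi>\<close> at the formal product of \<open>x\<close>
  and \<open>y\<close>. Nesting gives longer products:
  \<open>m (\<lambda>w. m \<phi> w z) x y\<close> is the value at the product of \<open>x\<close>,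
  \<open>y\<close>, \<open>z\<close> bracketed to the left.\<close>

definition m :: "('a \<Rightarrow> complex) \<Rightarrow> 'a \<Rightarrow> 'a \<Rightarrow> complex" where
  "m \<phi> x y = I (\<lambda>t. \<phi> (x * t * y))"

lemma continuous_translate:
  fixes x y :: 'a
  assumes "continuous_on UNIV \<phi>"
  shows "continuous_on UNIV (\<lambda>t. \<phi> (x * t * y))"
  by (rule continuous_compose[OF assms]) (intro continuous_on_mult' continuous_on_const continuous_on_id)

lemma continuous_m:
  assumes \<phi>: "continuous_on UNIV \<phi>"
  shows "continuous_on UNIV (\<lambda>x. m \<phi> x y)" "continuous_on UNIV (\<lambda>y. m \<phi> x y)"
  unfolding m_def
  by (rule continuous_parameter, unfold case_prod_beta, rule continuous_compose[OF \<phi>],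
      intro continuous_on_mult' continuous_on_fst continuous_on_snd continuous_on_const continuous_on_id)+

lemma m_add:
  "continuous_on UNIV \<phi> \<Longrightarrow> continuous_on UNIV \<eta> \<Longrightarrow> m (\<lambda>x. \<phi> x + \<eta> x) x y = m \<phi> x y + m \<eta> x y"
  and m_diff:
  "continuous_on UNIV \<phi> \<Longrightarrow> continuous_on UNIV \<eta> \<Longrightarrow> m (\<lambda>x. \<phi> x - \<eta> x) x y = m \<phi> x y - m \<eta> x y"
  and m_cmult: "continuous_on UNIV \<phi> \<Longrightarrow> m (\<lambda>x. c * \<phi> x) x y = c * m \<phi> x y"
  unfolding m_def by (simp_all add: add diff cmult continuous_translate)

text \<open>Both sides integrate \<open>\<phi> (x * t * y * s * z)\<close> over \<open>s\<close> and
  \<open>t\<close>, in opposite orders.\<close>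

lemma m_assoc:
  assumes \<phi>: "continuous_on UNIV \<phi>"
  shows "m (\<lambda>w. m \<phi> x w) y z = m (\<lambda>w. m \<phi> w z) x y"
proof -
  have "continuous_on UNIV (\<lambda>(s, t). \<phi> (x * t * (y * s * z)))"
    unfolding case_prod_beta
    by (rule continuous_compose[OF \<phi>])
      (intro continuous_on_mult' continuous_on_fst continuous_on_snd continuous_on_const continuous_on_id)
  from fubini[OF this] show ?thesis
    unfolding m_def by (simp add: mult.assoc)
qed

lemma m_sigma:
  assumes "continuous_on UNIV \<phi>"
  shows "m (\<lambda>x. \<phi> (\<sigma> x)) x y = m \<phi> (\<sigma> x) (\<sigma> y)"
  unfolding m_def using invariant[OF continuous_translate[OF assms], of "\<sigma> x" "\<sigma> y"]
  by (simp add: sigma_mult)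

text \<open>\<open>\<psi> \<circ> \<sigma>\<close> is spherical as well, so \<open>m f x y\<close>
  consists of the two unmixed products. Replacing the arguments by \<open>\<sigma> y\<close> and
  \<open>x\<close> yields the two mixed ones, and the sum of all four factors.\<close>

lemma dalembert_of_spherical:
  assumes \<psi>: "continuous_on UNIV \<psi>" and sph: "\<And>x y. m \<psi> x y = \<psi> x * \<psi> y"
    and f: "f = (\<lambda>x. (\<psi> x + \<psi> (\<sigma> x)) / 2)"
  shows "continuous_on UNIV f" "m f x y + m f (\<sigma> y) x = 2 * f x * f y"
proof -
  have \<psi>\<sigma>: "continuous_on UNIV (\<lambda>x. \<psi> (\<sigma> x))"
    by (rule continuous_compose[OF \<psi> continuous_sigma])
  have f': "f = (\<lambda>x. (1/2) * (\<psi> x + \<psi> (\<sigma> x)))"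
    by (simp add: f)
  show "continuous_on UNIV f"
    unfolding f' by (intro continuous_intros \<psi> \<psi>\<sigma>)
  have m_f: "m f x y = (\<psi> x * \<psi> y + \<psi> (\<sigma> x) * \<psi> (\<sigma> y)) / 2" for x y
    unfolding f' by (subst m_cmult) (simp_all add: m_add m_sigma sph continuous_intros \<psi> \<psi>\<sigma>)
  show "m f x y + m f (\<sigma> y) x = 2 * f x * f y"
    unfolding m_f by (simp add: f field_simps)
qed

section \<open>Structure of a continuous solution\<close>

context
  fixes f :: "'a \<Rightarrow> complex"
  assumes f: "continuous_on UNIV f"
    and eqn: "\<And>x y. m f x y + m f (\<sigma> y) x = 2 * f x * f y"
begin

text \<open>Subtracting the equation at \<open>(\<sigma> y, x)\<close> from that at
  \<open>(x, y)\<close> gives \<open>m h x y = 2 * f x * h y\<close> for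
  \<open>h = f - f \<circ> \<sigma>\<close>. As \<open>h\<close> is odd, applying
  \<open>\<sigma>\<close> to both arguments of \<open>m h x x\<close> changes its sign; by the
  product formula this forces \<open>f (\<sigma> x) = f x\<close> or \<open>h x = 0\<close>.\<close>

lemma even: "f (\<sigma> x) = f x"
proof -
  define h where "h x = f x - f (\<sigma> x)" for x
  have f\<sigma>: "continuous_on UNIV (\<lambda>x. f (\<sigma> x))"
    by (rule continuous_compose[OF f continuous_sigma])
  have h: "continuous_on UNIV h"
    unfolding h_def by (intro continuous_intros f f\<sigma>)
  have h_m: "m h x y = 2 * f x * h y" for x y
  proof -
    have "m h x y = m f x y - m f (\<sigma> x) (\<sigma> y)"
      unfolding h_def using f f\<sigma> by (simp add: m_diff m_sigma)
    also have "\<dots> = 2 * f x * f y - 2 * f (\<sigma> y) * f x"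
      using arg_cong2[OF eqn[of x y] eqn[of "\<sigma> y" x], of "(-)"] by simp
    finally show ?thesis by (simp add: h_def algebra_simps)
  qed
  have odd: "h (\<sigma> x) = - h x" for x
    by (simp add: h_def)
  have "m h (\<sigma> x) (\<sigma> x) = - m h x x"
    using m_sigma[OF h, of x x] m_cmult[OF h, of "-1" x x] by (simp add: odd)
  then have "f (\<sigma> x) = f x \<or> h x = 0"
    by (auto simp: h_m odd)
  then show ?thesis unfolding h_def by (metis right_minus_eq)
qed

lemma triple_product:
  "m (\<lambda>w. m f w z) x y = f x * m f y z + f y * m f x z + f z * m f x y - 2 * f x * f y * f z"
proof -
  define T where "T x y z = m (\<lambda>w. m f w z) x y" for x y z
  have T': "m (\<lambda>w. m f x w) y z = T x y z" for x y z
    unfolding T_def by (rule m_assoc[OF f])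
  note cont = continuous_m[OF f] continuous_compose[OF continuous_m(1)[OF f] continuous_sigma] f
  have 1: "T x y z + T (\<sigma> y) (\<sigma> z) x = 2 * f x * m f y z"
  proof -
    have "m (\<lambda>w. m f x w + m f (\<sigma> w) x) y z = m (\<lambda>w. 2 * f x * f w) y z"
      by (simp add: eqn)
    then show ?thesis
      by (simp add: m_add m_cmult cont T' m_sigma[OF cont(1)]) (simp add: T_def)
  qed
  have 2: "T x y z + T w x y = 2 * f z * m f x y" if "w = \<sigma> z" for x y z w
  proof -
    have "m (\<lambda>w. m f w z + m f (\<sigma> z) w) x y = m (\<lambda>w. 2 * f z * f w) x y"
      by (simp add: eqn mult.commute mult.left_commute)
    then show ?thesis
      by (simp add: m_add m_cmult cont T' that) (simp add: T_def)
  qed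
  have 3: "m f (\<sigma> z) x = 2 * f x * f z - m f x z"
    using eqn[of x z] by (simp add: algebra_simps)
  \<comment> \<open>Each bracket is an instance of the equation with a product as one argument:
    \<open>x\<close> against \<open>y\<close>, \<open>z\<close>; then \<open>x\<close>,
    \<open>y\<close> against \<open>z\<close>; then \<open>\<sigma> z\<close>, \<open>x\<close>
    against \<open>y\<close>. The terms containing \<open>\<sigma>\<close> cancel.\<close>
  have "2 * T x y z = (T x y z + T (\<sigma> y) (\<sigma> z) x) + (T x y z + T (\<sigma> z) x y)
      - (T (\<sigma> z) x y + T (\<sigma> y) (\<sigma> z) x)"
    by simp
  also have "\<dots> = 2 * f x * m f y z + 2 * f z * m f x y - 2 * f y * (2 * f x * f z - m f x z)"
    using 1 2[of "\<sigma> z" z x y] 2[of "\<sigma> y" y "\<sigma> z" x] 3 by simp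
  also have "\<dots> = 2 * (f x * m f y z + f y * m f x z + f z * m f x y - 2 * f x * f y * f z)"
    by (simp add: algebra_simps)
  finally show ?thesis
    unfolding T_def mult_cancel_left by simp
qed

lemma spherical_of_dalembert:
  "\<exists>\<psi>. continuous_on UNIV \<psi> \<and> (\<forall>x y. m \<psi> x y = \<psi> x * \<psi> y) \<and>
    f = (\<lambda>x. (\<psi> x + \<psi> (\<sigma> x)) / 2)"
proof (cases "\<forall>x y. m f x y = f x * f y")
  case True
  then show ?thesis
    using f even by (intro exI[of _ f]) auto
next
  case False
  then obtain z a where za: "m f z a \<noteq> f z * f a" by blast
  define h where "h x = m f x a - f a * f x" for x
  have h: "continuous_on UNIV h"
    unfolding h_def by (intro continuous_intros continuous_m f)
  have hz: "h z \<noteq> 0"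
    using za by (simp add: h_def mult.commute)
  \<comment> \<open>\<open>triple_product\<close> with \<open>a\<close> as third argument; its term
    \<open>f a * m f x y\<close> cancels against the one from \<open>h\<close>.\<close>
  have sine: "m h x y = h x * f y + f x * h y" for x y
  proof -
    have "m h x y = m (\<lambda>w. m f w a) x y - f a * m f x y"
      unfolding h_def using f by (simp add: m_diff m_cmult continuous_m continuous_intros)
    then show ?thesis
      by (simp add: triple_product h_def algebra_simps)
  qed
  \<comment> \<open>The sine law expands the value of \<open>h\<close> at the product of
    \<open>x\<close>, \<open>y\<close>, \<open>w\<close> in both bracketings; comparing the results
    separates the variables.\<close>
  have cross: "h w * (m f x y - f x * f y) = h x * (m f y w - f y * f w)" for x y w
  proof -
    have "m (\<lambda>v. h x * f v + f x * h v) y w = m (\<lambda>v. h v * f w + f v * h w) x y"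
      using m_assoc[OF h, of x y w] by (simp add: sine)
    moreover have "m (\<lambda>v. h x * f v + f x * h v) y w = h x * m f y w + f x * m h y w"
      using f h by (simp add: m_add m_cmult continuous_intros)
    moreover have "m (\<lambda>v. h v * f w + f v * h w) x y = f w * m h x y + h w * m f x y"
      using f h by (simp add: m_add m_cmult continuous_intros mult.commute[of _ "f w"] mult.commute[of _ "h w"])
    ultimately show ?thesis
      by (simp add: sine algebra_simps)
  qed
  \<comment> \<open>Using \<open>cross\<close> twice with \<open>z\<close> as pivot shows
    \<open>m f x y - f x * f y\<close> to be this quotient times \<open>h x * h y\<close>. The other
    square root would merely exchange \<open>\<psi>\<close> and
    \<open>\<psi> \<circ> \<sigma>\<close>.\<close>
  define b where "b = csqrt ((m f z z - f z * f z) / (h z * h z))"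
  have bb: "b * b = (m f z z - f z * f z) / (h z * h z)"
    unfolding b_def using power2_csqrt by (simp flip: power2_eq_square)
  have cosine: "m f x y = f x * f y + b * b * h x * h y" for x y
  proof -
    have "m f x y - f x * f y = h x * (m f y z - f y * f z) / h z"
      using cross[of z x y] hz by (simp add: field_simps)
    also have "m f y z - f y * f z = h y * (m f z z - f z * f z) / h z"
      using cross[of z y z] hz by (simp add: field_simps)
    finally show ?thesis
      using hz by (simp add: bb field_simps)
  qed
  have b: "b \<noteq> 0"
    using cosine[of z a] za by auto
  \<comment> \<open>With \<open>cosine\<close> and evenness of \<open>f\<close>, the equation at
    \<open>(z, y)\<close> leaves only the terms in \<open>h\<close>.\<close>
  have odd: "h (\<sigma> y) = - h y" for y
  proof -
    have "b * b * h z * (h y + h (\<sigma> y)) = 0"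
      using eqn[of z y] by (simp add: cosine even algebra_simps)
    then show ?thesis
      using b hz by (simp add: add_eq_0_iff2)
  qed
  show ?thesis
  \<comment> \<open>Multiplicativity is \<open>cosine\<close> plus \<open>b\<close> times
    \<open>sine\<close>; since \<open>h\<close> is odd, averaging with the composite with
    \<open>\<sigma>\<close> removes \<open>b * h\<close>.\<close>
  proof (intro exI[of _ "\<lambda>x. f x + b * h x"] conjI allI)
    show "continuous_on UNIV (\<lambda>x. f x + b * h x)"
      by (intro continuous_intros f h)
    show "m (\<lambda>x. f x + b * h x) x y = (f x + b * h x) * (f y + b * h y)" for x y
      using f h by (simp add: m_add m_cmult continuous_intros sine cosine) (simp add: algebra_simps)
    show "f = (\<lambda>x. (f x + b * h x + (f (\<sigma> x) + b * h (\<sigma> x))) / 2)"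
      by (simp add: even odd)
  qed
qed

end

end

theorem theorem3p2:
  fixes \<sigma> :: "'a::topological_semigroup_mult \<Rightarrow> 'a"
    and \<upsilon> :: "'a set \<Rightarrow> complex"
    and f :: "'a \<Rightarrow> complex"
  assumes "locally_compact_space (euclidean :: 'a topology)"
    and "involutive_automorphism \<sigma>"
    and "continuous_on UNIV \<sigma>"
    and "complex_borel_measure \<upsilon>"
    and "has_compact_support \<upsilon>"
    and "measure_invariant \<upsilon> \<sigma>"
  shows "(continuous_on UNIV f \<and>
           (\<forall>x y. complex_measure_integral \<upsilon> (\<lambda>t. f (x * t * y)) +
                  complex_measure_integral \<upsilon> (\<lambda>t. f (\<sigma> y * t * x)) = 2 * f x * f y))
     \<longleftrightarrow> (\<exists>\<psi>. continuous_on UNIV \<psi> \<and> spherical_function \<upsilon> \<psi> \<and>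
              f = (\<lambda>x. (\<psi> x + \<psi> (\<sigma> x)) / 2))"
proof -
  obtain K C where "compact_functional (complex_measure_integral \<upsilon>) K C"
    using compact_functional_complex_measure_integral[OF assms(4,5)] by blast
  then interpret involutive_functional "complex_measure_integral \<upsilon>" K C \<sigma>
    using assms(2,3,6)
    unfolding involutive_functional_def involutive_functional_axioms_def
      involutive_automorphism_def measure_invariant_def by blast
  show ?thesis
    unfolding spherical_function_def m_def[symmetric]
    using spherical_of_dalembert[of f] dalembert_of_spherical[of _ f] by blast
qed

end
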